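(* Let $\mathcal{B}$ be an infinite-dimensional reflexive Banach space over $\mathbb{K}\in\{\mathbb{R},\mathbb{C}\}$. Then for any compact topological space $\Lambda$ and any system $\Phi=(\varphi_\lambda)_{\lambda\in\Lambda}\subset\mathcal{B}'$ for which $\lambda\mapsto\varphi_\lambda$ is continuous, $\Phi$ cannot constitute a frame for $\mathcal{B}$. In particular, for any admissible Banach space $\mathfrak{B}\subset\mathbb{K}^\Lambda$ there is no constant $A>0$ such that $$A\|x\|_{\mathcal{B}}\le\|[x,\Phi]\|_{\mathfrak{B}}\quad\text{for all }x\in\mathcal{B}.$$
   Context: Notation. $\mathcal{B}'$ is the topological dual of $\mathcal{B}$ with its norm, $[x,\psi]:=\psi(x)$, and $[x,\Phi]:=([x,\varphi_\lambda])_{\lambda\in\Lambda}\in\mathbb{K}^\Lambda$. For $S\subset\Lambda$, $\chi_S$ is the indicator function of $S$; absolute values in $\mathbb{K}^\Lambda$ are pointwise. Admissible Banach space. Let $\Lambda$ be a $\sigma$-compact topological space. A Banach space $\mathfrak{B}\subset\mathbb{K}^\Lambda$ over $\mathbb{K}$ is admissible if (with the convention $\|w\|_{\mathfrak{B}}=\infty$ for $w\in\mathbb{K}^\Lambda\setminus\mathfrak{B}$): (i) $\|\chi_{\Lambda'}\|_{\mathfrak{B}}<\infty$ for every compact $\Lambda'\subset\Lambda$; (ii) $\mathfrak{B}$ is solid: $\|w\|_{\mathfrak{B}}=\||w|\|_{\mathfrak{B}}\le\|z\|_{\mathfrak{B}}$ for all $z\in\mathfrak{B}$ and $w$ with $|z(\lambda)|\ge|w(\lambda)|$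 for all $\lambda\in\Lambda$; (iii) the elements of $\mathfrak{B}$ with compact support are dense in $\mathfrak{B}$. Frame. A family $\Phi=(\varphi_\lambda)_{\lambda\in\Lambda}\subset\mathcal{B}'$ with $\lambda\mapsto\varphi_\lambda$ continuous is a frame for $\mathcal{B}$ if there is an admissible Banach space $\mathfrak{B}\subset\mathbb{K}^\Lambda$ such that (B1) there are real constants $B\ge A>0$ with $A\|x\|_{\mathcal{B}}\le\|[x,\Phi]\|_{\mathfrak{B}}\le B\|x\|_{\mathcal{B}}$ for all $x\in\mathcal{B}$; and (B2) there is a continuous operator $R:\mathfrak{B}\to\mathcal{B}$ with $R([x,\Phi])=x$ for all $x\in\mathcal{B}$. *)

theory Defs
  imports "HOL-Analysis.Analysis" "HOL-Library.Function_Algebras"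
begin

text \<open>
  The scalar field is either the reals or the complex numbers.  The class contains exactly the
  normed fields that are isometrically isomorphic to one of the two, so that a type variable of
  this class ranges over both cases.
\<close>

class real_or_complex = real_normed_field +
  assumes real_or_complex:
    "(\<exists>h :: 'a \<Rightarrow> real. bij h \<and> (\<forall>x y. h (x + y) = h x + h y) \<and> (\<forall>x y. h (x * y) = h x * h y)
        \<and> (\<forall>r x. h (r *\<^sub>R x) = r *\<^sub>R h x) \<and> (\<forall>x. norm (h x) = norm x)) \<or>
     (\<exists>h :: 'a \<Rightarrow> complex. bij h \<and> (\<forall>x y. h (x + y) = h x + h y) \<and> (\<forall>x y. h (x * y) = h x * h y)
        \<and> (\<forall>r x. h (r *\<^sub>R x) = r *\<^sub>R h x) \<and> (\<forall>x. norm (h x) = norm x))"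

instance real :: real_or_complex
  by standard (rule disjI1, rule exI[of _ "\<lambda>x. x"], auto intro: bijI')

instance complex :: real_or_complex
  by standard (rule disjI2, rule exI[of _ "\<lambda>x. x"], auto intro: bijI')


section \<open>Banach spaces over the scalar field, dual and reflexivity\<close>

text \<open>
  The class \<^class>\<open>banach\<close> only provides real scalars; the scalar multiplication by
  \<open>'k\<close> is an additional parameter which extends the real one.
\<close>

locale banach_over = vector_space smul
  for smul :: "'k::real_or_complex \<Rightarrow> 'b::banach \<Rightarrow> 'b" +
  assumes scale_of_real: "smul (of_real r) x = r *\<^sub>R x"
    and norm_scale: "norm (smul c x) = norm c * norm x"

lemma banach_over_scaleR: "banach_over (scaleR :: real \<Rightarrow> 'b::banach \<Rightarrow> 'b)"
  by unfold_locales (auto simp: algebra_simps)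

lemma banach_over_complex: "banach_over ((*) :: complex \<Rightarrow> complex \<Rightarrow> complex)"
  by unfold_locales (auto simp: algebra_simps scaleR_conv_of_real norm_mult)

definition infinite_dimensional :: "('k::real_or_complex \<Rightarrow> 'b::banach \<Rightarrow> 'b) \<Rightarrow> bool" where
  "infinite_dimensional smul \<longleftrightarrow> \<not> (\<exists>S. finite S \<and> module.span smul S = UNIV)"

text \<open>
  The topological dual consists of the bounded functionals that are linear over \<open>'k\<close>.  Its norm
  and topology are those of the type of bounded (real-linear) maps, i.e. the operator norm.
\<close>

definition dual :: "('k::real_or_complex \<Rightarrow> 'b::banach \<Rightarrow> 'b) \<Rightarrow> ('b \<Rightarrow>\<^sub>L 'k) set" where
  "dual smul = {\<psi>. \<forall>c x. blinfun_apply \<psi> (smul c x) = c * blinfun_apply \<psi> x}"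

text \<open>
  Reflexivity: the canonical embedding into the bidual is onto.  The scalar multiple of a
  functional \<open>\<psi>\<close> by \<open>c\<close> is \<open>blinfun_mult_right c o\<^sub>L \<psi>\<close>.
\<close>

definition bidual :: "('k::real_or_complex \<Rightarrow> 'b::banach \<Rightarrow> 'b) \<Rightarrow> (('b \<Rightarrow>\<^sub>L 'k) \<Rightarrow> 'k) set" where
  "bidual smul = {F. continuous_on (dual smul) F
     \<and> (\<forall>\<psi>\<in>dual smul. \<forall>\<psi>'\<in>dual smul. F (\<psi> + \<psi>') = F \<psi> + F \<psi>')
     \<and> (\<forall>c. \<forall>\<psi>\<in>dual smul. F (blinfun_mult_right c o\<^sub>L \<psi>) = c * F \<psi>)}"

definition reflexive :: "('k::real_or_complex \<Rightarrow> 'b::banach \<Rightarrow> 'b) \<Rightarrow> bool" where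
  "reflexive smul \<longleftrightarrow>
     (\<forall>F\<in>bidual smul. \<exists>x. \<forall>\<psi>\<in>dual smul. F \<psi> = blinfun_apply \<psi> x)"


section \<open>Admissible Banach spaces of functions\<close>

text \<open>
  A topological space \<open>\<Lambda>\<close> is a value \<open>X\<close> of type \<open>'l topology\<close>, and
  \<open>\<Lambda>\<close> itself is \<open>topspace X\<close>.  An element of the space of all scalar-valued functions on
  \<open>\<Lambda>\<close> is represented by the total function extending it by \<open>0\<close>.
\<close>

definition functions_on :: "'l set \<Rightarrow> ('l \<Rightarrow> 'k::real_or_complex) set" where
  "functions_on S = {w. \<forall>l. l \<notin> S \<longrightarrow> w l = 0}"

definition fun_scale :: "'k::real_or_complex \<Rightarrow> ('l \<Rightarrow> 'k) \<Rightarrow> 'l \<Rightarrow> 'k" where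
  "fun_scale c w = (\<lambda>l. c * w l)"

text \<open>
  The type of a normed space cannot depend on the set \<open>W\<close>, so the norm is a total function
  \<open>nrm\<close> that is relevant on \<open>W\<close> only.  The distance is set to \<open>0\<close> off
  \<open>W\<close> because \<^locale>\<open>Metric_space\<close> demands symmetry and nonnegativity everywhere.
\<close>

definition norm_dist ::
    "('l \<Rightarrow> 'k::real_or_complex) set \<Rightarrow> (('l \<Rightarrow> 'k) \<Rightarrow> real) \<Rightarrow> ('l \<Rightarrow> 'k) \<Rightarrow> ('l \<Rightarrow> 'k) \<Rightarrow> real" where
  "norm_dist W nrm w z = (if w \<in> W \<and> z \<in> W then nrm (w - z) else 0)"

abbreviation norm_topology ::
    "('l \<Rightarrow> 'k::real_or_complex) set \<Rightarrow> (('l \<Rightarrow> 'k) \<Rightarrow> real) \<Rightarrow> ('l \<Rightarrow> 'k) topology" where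
  "norm_topology W nrm \<equiv> Metric_space.mtopology W (norm_dist W nrm)"

locale banach_function_space =
  fixes X :: "'l topology"
    and W :: "('l \<Rightarrow> 'k::real_or_complex) set"
    and nrm :: "('l \<Rightarrow> 'k) \<Rightarrow> real"
  assumes subset_functions: "W \<subseteq> functions_on (topspace X)"
    and subspace: "module.subspace fun_scale W"
    and nrm_nonneg: "w \<in> W \<Longrightarrow> 0 \<le> nrm w"
    and nrm_eq_0_iff: "w \<in> W \<Longrightarrow> nrm w = 0 \<longleftrightarrow> w = 0"
    and nrm_triangle: "w \<in> W \<Longrightarrow> z \<in> W \<Longrightarrow> nrm (w + z) \<le> nrm w + nrm z"
    and nrm_scale: "w \<in> W \<Longrightarrow> nrm (fun_scale c w) = norm c * nrm w"
    and complete: "Metric_space.mcomplete W (norm_dist W nrm)"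

lemma module_fun_scale: "module (fun_scale :: 'k::real_or_complex \<Rightarrow> ('l \<Rightarrow> 'k) \<Rightarrow> 'l \<Rightarrow> 'k)"
  by unfold_locales (auto simp: fun_scale_def fun_eq_iff algebra_simps)

lemma (in banach_function_space) Metric_space_norm_dist: "Metric_space W (norm_dist W nrm)"
proof -
  have diff: "w - z \<in> W" if "w \<in> W" "z \<in> W" for w z
    using module.subspace_diff[OF module_fun_scale subspace] that by blast
  have neg: "fun_scale (-1) w = - w" for w :: "'l \<Rightarrow> 'k"
    by (auto simp: fun_scale_def fun_eq_iff)
  have comm: "nrm (w - z) = nrm (z - w)" if "w \<in> W" "z \<in> W" for w z
    using nrm_scale[OF diff[OF that], of "-1"] by (simp add: neg)
  have tri: "nrm (w - z) \<le> nrm (w - y) + nrm (y - z)" if "w \<in> W" "y \<in> W" "z \<in> W" for w y z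
    using nrm_triangle[OF diff[of w y] diff[of y z]] that by simp
  show ?thesis
    by unfold_locales (auto simp: norm_dist_def diff nrm_nonneg nrm_eq_0_iff comm intro: tri)
qed

definition ext_norm ::
    "('l \<Rightarrow> 'k::real_or_complex) set \<Rightarrow> (('l \<Rightarrow> 'k) \<Rightarrow> real) \<Rightarrow> ('l \<Rightarrow> 'k) \<Rightarrow> ereal" where
  "ext_norm W nrm w = (if w \<in> W then ereal (nrm w) else \<infinity>)"

definition fun_abs :: "('l \<Rightarrow> 'k::real_or_complex) \<Rightarrow> 'l \<Rightarrow> 'k" where
  "fun_abs w = (\<lambda>l. of_real (norm (w l)))"

definition sigma_compact_space :: "'l topology \<Rightarrow> bool" where
  "sigma_compact_space X \<longleftrightarrow>
     (\<exists>\<K>. countable \<K> \<and> (\<forall>K\<in>\<K>. compactin X K) \<and> \<Union>\<K> = topspace X)"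

definition compact_support :: "'l topology \<Rightarrow> ('l \<Rightarrow> 'k::real_or_complex) \<Rightarrow> bool" where
  "compact_support X w \<longleftrightarrow> compactin X (X closure_of {l \<in> topspace X. w l \<noteq> 0})"

locale admissible = banach_function_space X W nrm
  for X :: "'l topology"
    and W :: "('l \<Rightarrow> 'k::real_or_complex) set"
    and nrm :: "('l \<Rightarrow> 'k) \<Rightarrow> real" +
  assumes sigma_compact: "sigma_compact_space X"
    and indicator_finite: "compactin X K \<Longrightarrow> ext_norm W nrm (indicator K) < \<infinity>"
    and solid: "z \<in> W \<Longrightarrow> w \<in> functions_on (topspace X) \<Longrightarrow>
      (\<And>l. l \<in> topspace X \<Longrightarrow> norm (z l) \<ge> norm (w l)) \<Longrightarrow>
      ext_norm W nrm w = ext_norm W nrm (fun_abs w) \<and> ext_norm W nrm (fun_abs w) \<le> ext_norm W nrm z"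
    and dense: "norm_topology W nrm closure_of {w \<in> W. compact_support X w} = W"


section \<open>Frames\<close>

definition pairing ::
    "'l topology \<Rightarrow> ('l \<Rightarrow> 'b::banach \<Rightarrow>\<^sub>L 'k::real_or_complex) \<Rightarrow> 'b \<Rightarrow> 'l \<Rightarrow> 'k" where
  "pairing X \<Phi> x = (\<lambda>l. if l \<in> topspace X then blinfun_apply (\<Phi> l) x else 0)"

definition continuous_family ::
    "'l topology \<Rightarrow> ('k::real_or_complex \<Rightarrow> 'b::banach \<Rightarrow> 'b) \<Rightarrow> ('l \<Rightarrow> 'b \<Rightarrow>\<^sub>L 'k) \<Rightarrow> bool" where
  "continuous_family X smul \<Phi> \<longleftrightarrow>
     (\<forall>l\<in>topspace X. \<Phi> l \<in> dual smul) \<and> continuous_map X euclidean \<Phi>"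

definition continuous_operator ::
    "('l \<Rightarrow> 'k::real_or_complex) set \<Rightarrow> (('l \<Rightarrow> 'k) \<Rightarrow> real) \<Rightarrow> ('k \<Rightarrow> 'b::banach \<Rightarrow> 'b)
       \<Rightarrow> (('l \<Rightarrow> 'k) \<Rightarrow> 'b) \<Rightarrow> bool" where
  "continuous_operator W nrm smul R \<longleftrightarrow>
     (\<forall>w\<in>W. \<forall>z\<in>W. R (w + z) = R w + R z) \<and>
     (\<forall>c. \<forall>w\<in>W. R (fun_scale c w) = smul c (R w)) \<and>
     continuous_map (norm_topology W nrm) euclidean R"

definition frame ::
    "'l topology \<Rightarrow> ('k::real_or_complex \<Rightarrow> 'b::banach \<Rightarrow> 'b) \<Rightarrow> ('l \<Rightarrow> 'b \<Rightarrow>\<^sub>L 'k) \<Rightarrow> bool" where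
  "frame X smul \<Phi> \<longleftrightarrow> continuous_family X smul \<Phi> \<and>
     (\<exists>W nrm. admissible X W nrm \<and>
        (\<exists>A B::real. 0 < A \<and> A \<le> B \<and>
           (\<forall>x. ereal (A * norm x) \<le> ext_norm W nrm (pairing X \<Phi> x) \<and>
                ext_norm W nrm (pairing X \<Phi> x) \<le> ereal (B * norm x))) \<and>
        (\<exists>R. continuous_operator W nrm smul R \<and> (\<forall>x. R (pairing X \<Phi> x) = x)))"

end

theory Submission
  imports Defs
begin

text \<open>
  The obstruction is the compactness of the family of functionals.  Since \<open>\<Lambda>\<close> is compact and
  \<open>\<lambda> \<mapsto> \<phi>\<^sub>\<lambda>\<close> is norm continuous, the set of all \<open>\<phi>\<^sub>\<lambda>\<close> is compact in the dual, hence
  totally bounded: for \<open>\<epsilon> > 0\<close> finitely many members form an \<open>\<epsilon>\<close>-net.  Finitely many functionals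
  on an infinite-dimensional space have a common zero \<open>x \<noteq> 0\<close>
  (\<open>nonzero_in_common_kernel\<close>), and at this \<open>x\<close> every \<open>\<phi>\<^sub>\<lambda>\<close> is then at most
  \<open>\<epsilon> \<parallel>x\<parallel>\<close> in absolute value (\<open>uniformly_small_pairing\<close>).

  On the other side, a compact \<open>\<Lambda>\<close> has its own indicator function in every admissible space, so by
  solidity the norm of that space is dominated by a multiple \<open>C\<close> of the supremum norm
  (\<open>admissible.ext_norm_le_sup_bound\<close>).  A lower frame bound \<open>A\<close> would thus satisfy
  \<open>A \<parallel>x\<parallel> \<le> \<epsilon> C \<parallel>x\<parallel>\<close>, which is absurd once \<open>\<epsilon> C < A\<close>.  A frame has a lower frame bound in
  some admissible space, so the first claim follows from the second.
\<close>

text \<open>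
  A subspace cut out by finitely many linear equations has finite codimension.  Each further
  functional either vanishes on the kernel reached so far, or it takes the value \<open>1\<close> at some \<open>v\<close> in
  that kernel, and then adding \<open>v\<close> to the spanning set compensates for the new equation.
\<close>

lemma (in vector_space) finite_codim_common_kernel:
  assumes "finite F" and "\<And>f. f \<in> F \<Longrightarrow> Vector_Spaces.linear scale (*) f"
  shows "\<exists>S. finite S \<and> (\<forall>x. \<exists>s\<in>span S. \<forall>f\<in>F. f (x - s) = 0)"
  using assms
proof (induction F rule: finite_induct)
  case empty
  show ?case by (intro exI[of _ "{}"]) auto
next
  case (insert g F)
  from insert obtain S where S: "finite S" "\<And>x. \<exists>s\<in>span S. \<forall>f\<in>F. f (x - s) = 0"
    by auto
  have lin: "f (x - y) = f x - f y" "f (scale c x) = c * f x" if "f \<in> insert g F" for f x y c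
    using insert.prems[OF that] by (simp_all add: linear_iff_module_hom module_hom.diff module_hom.scale)
  show ?case
  proof (cases "\<forall>y. (\<forall>f\<in>F. f y = 0) \<longrightarrow> g y = 0")
    case True
    then show ?thesis using S by (intro exI[of _ S]) (simp, blast)
  next
    case False
    then obtain y where y: "\<And>f. f \<in> F \<Longrightarrow> f y = 0" "g y \<noteq> 0" by auto
    define v where "v = scale (1 / g y) y"
    have v: "\<And>f. f \<in> F \<Longrightarrow> f v = 0" "g v = 1"
      using y by (simp_all add: v_def lin)
    have "\<exists>t\<in>span (insert v S). \<forall>f\<in>insert g F. f (x - t) = 0" for x
    proof -
      obtain s where s: "s \<in> span S" "\<And>f. f \<in> F \<Longrightarrow> f (x - s) = 0" using S by blast
      let ?t = "s + scale (g (x - s)) v"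
      have "?t \<in> span (insert v S)"
        using s(1) span_mono[OF subset_insertI[of S v]] by (blast intro: span_add span_scale span_base)
      moreover have "f (x - ?t) = 0" if f: "f \<in> insert g F" for f
      proof -
        have "f (x - ?t) = f (x - s) - g (x - s) * f v"
          using lin[OF f] by (simp add: diff_diff_eq[symmetric] del: diff_diff_eq)
        then show ?thesis using f s(2)[of f] v(1)[of f] v(2) by auto
      qed
      ultimately show ?thesis by blast
    qed
    then show ?thesis using S(1) by (intro exI[of _ "insert v S"]) auto
  qed
qed

lemma (in banach_over) nonzero_in_common_kernel:
  assumes "infinite_dimensional smul" and "finite F" and "F \<subseteq> dual smul"
  obtains x where "x \<noteq> 0" and "\<And>\<psi>. \<psi> \<in> F \<Longrightarrow> blinfun_apply \<psi> x = 0"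
proof -
  have "Vector_Spaces.linear smul (*) f" if "f \<in> blinfun_apply ` F" for f
    using that assms(3)
    by unfold_locales (auto simp: dual_def blinfun.add_right algebra_simps)
  then obtain S where S: "finite S" "\<And>x. \<exists>s\<in>span S. \<forall>f\<in>blinfun_apply ` F. f (x - s) = 0"
    using finite_codim_common_kernel[of "blinfun_apply ` F"] assms(2) by auto
  have "span S \<noteq> UNIV" using assms(1) S(1) by (auto simp: infinite_dimensional_def)
  then obtain x where x: "x \<notin> span S" by auto
  obtain s where "s \<in> span S" "\<forall>f\<in>blinfun_apply ` F. f (x - s) = 0" using S(2) by blast
  then show ?thesis using x that[of "x - s"] by auto
qed

lemma uniformly_small_pairing:
  fixes smul :: "'k::real_or_complex \<Rightarrow> 'b::banach \<Rightarrow> 'b"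
    and \<Phi> :: "'l \<Rightarrow> 'b \<Rightarrow>\<^sub>L 'k"
  assumes "banach_over smul" and "infinite_dimensional smul"
    and "compact_space X" and "continuous_family X smul \<Phi>" and "\<epsilon> > 0"
  obtains x where "x \<noteq> 0" and "\<And>l. norm (pairing X \<Phi> x l) \<le> \<epsilon> * norm x"
proof -
  have "compact (\<Phi> ` topspace X)"
    using assms(3,4) image_compactin[of X "topspace X" euclidean \<Phi>]
    by (simp add: continuous_family_def compact_space_def)
  then obtain F where F: "finite F" "F \<subseteq> \<Phi> ` topspace X" "\<Phi> ` topspace X \<subseteq> (\<Union>\<psi>\<in>F. ball \<psi> \<epsilon>)"
    using compact_imp_seq_compact seq_compact_imp_totally_bounded assms(5) by metis
  have "F \<subseteq> dual smul" using F(2) assms(4) by (auto simp: continuous_family_def)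
  then obtain x where x: "x \<noteq> 0" "\<And>\<psi>. \<psi> \<in> F \<Longrightarrow> blinfun_apply \<psi> x = 0"
    using banach_over.nonzero_in_common_kernel[OF assms(1,2) F(1)] by blast
  have "norm (pairing X \<Phi> x l) \<le> \<epsilon> * norm x" for l
  proof (cases "l \<in> topspace X")
    case True
    then obtain \<psi> where \<psi>: "\<psi> \<in> F" "norm (\<Phi> l - \<psi>) < \<epsilon>"
      using F(3) by (auto simp: dist_norm norm_minus_commute)
    have "norm (\<Phi> l x) = norm ((\<Phi> l - \<psi>) x)"
      using x(2)[OF \<psi>(1)] by (simp add: blinfun.diff_left)
    also have "\<dots> \<le> norm (\<Phi> l - \<psi>) * norm x" by (rule norm_blinfun)
    also have "\<dots> \<le> \<epsilon> * norm x" using \<psi>(2) by (intro mult_right_mono) auto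
    finally show ?thesis using True by (simp add: pairing_def)
  qed (use assms(5) in \<open>simp add: pairing_def\<close>)
  then show ?thesis using that x(1) by blast
qed

text \<open>
  A function bounded by \<open>M\<close> is dominated pointwise by \<open>M\<close> times the indicator of the whole space,
  which belongs to the function space when the underlying space is compact; \<open>C\<close> is the norm of
  that indicator.
\<close>

lemma (in admissible) ext_norm_le_sup_bound:
  assumes "compact_space X"
  obtains C where "C \<ge> 0"
    and "\<And>w M. w \<in> functions_on (topspace X) \<Longrightarrow> M \<ge> 0 \<Longrightarrow> (\<And>l. norm (w l) \<le> M) \<Longrightarrow>
      ext_norm W nrm w \<le> ereal (M * C)"
proof -
  let ?\<chi> = "indicator (topspace X) :: 'l \<Rightarrow> 'k"
  have \<chi>: "?\<chi> \<in> W"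
    using indicator_finite[of "topspace X"] assms
    by (auto simp: ext_norm_def compact_space_def split: if_splits)
  have "ext_norm W nrm w \<le> ereal (M * nrm ?\<chi>)"
    if w: "w \<in> functions_on (topspace X)" and M: "M \<ge> 0" "\<And>l. norm (w l) \<le> M" for w M
  proof -
    let ?z = "fun_scale (of_real M) ?\<chi>"
    have z: "?z \<in> W"
      using module.subspace_scale[OF module_fun_scale subspace \<chi>] .
    have "norm (w l) \<le> norm (?z l)" if "l \<in> topspace X" for l
      using M that by (simp add: fun_scale_def)
    from solid[OF z w this] have "ext_norm W nrm w \<le> ext_norm W nrm ?z" by auto
    also have "\<dots> = ereal (M * nrm ?\<chi>)"
      using z M(1) nrm_scale[OF \<chi>] by (simp add: ext_norm_def)
    finally show ?thesis .
  qed
  then show ?thesis using that nrm_nonneg[OF \<chi>] by blast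
qed

lemma no_lower_frame_bound:
  fixes smul :: "'k::real_or_complex \<Rightarrow> 'b::banach \<Rightarrow> 'b"
    and \<Phi> :: "'l \<Rightarrow> 'b \<Rightarrow>\<^sub>L 'k"
  assumes "banach_over smul" and "infinite_dimensional smul"
    and "compact_space X" and "continuous_family X smul \<Phi>"
    and "admissible X W nrm" and "A > 0"
  shows "\<exists>x. ext_norm W nrm (pairing X \<Phi> x) < ereal (A * norm x)"
proof -
  obtain C where C: "C \<ge> 0"
    "\<And>w M. w \<in> functions_on (topspace X) \<Longrightarrow> M \<ge> 0 \<Longrightarrow> (\<And>l. norm (w l) \<le> M) \<Longrightarrow>
      ext_norm W nrm w \<le> ereal (M * C)"
    using admissible.ext_norm_le_sup_bound[OF assms(5,3)] by blast
  \<comment> \<open>Dividing by \<open>C + 1\<close> rather than \<open>C\<close> covers an empty index space, where \<open>C = 0\<close>, and makes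
    \<open>\<epsilon> C < A\<close> strict.\<close>
  define \<epsilon> where "\<epsilon> = A / (C + 1)"
  have \<epsilon>: "\<epsilon> > 0" "\<epsilon> * C < A" using C(1) assms(6) by (auto simp: \<epsilon>_def field_simps)
  obtain x where x: "x \<noteq> 0" "\<And>l. norm (pairing X \<Phi> x l) \<le> \<epsilon> * norm x"
    using uniformly_small_pairing[OF assms(1-4) \<epsilon>(1)] by blast
  have "ext_norm W nrm (pairing X \<Phi> x) \<le> ereal (\<epsilon> * norm x * C)"
    using \<epsilon>(1) x(2) by (intro C(2)) (auto simp: functions_on_def pairing_def)
  also have "\<dots> < ereal (A * norm x)"
    using mult_strict_right_mono[OF \<epsilon>(2), of "norm x"] x(1) by (simp add: mult_ac)
  finally show ?thesis ..
qed

theorem theorem3p12: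
  fixes smul :: "'k::real_or_complex \<Rightarrow> 'b::banach \<Rightarrow> 'b"
    and X :: "'l topology"
    and \<Phi> :: "'l \<Rightarrow> 'b \<Rightarrow>\<^sub>L 'k"
  assumes "banach_over smul"
    and "infinite_dimensional smul"
    and "reflexive smul"
    and "compact_space X"
    and "continuous_family X smul \<Phi>"
  shows "\<not> frame X smul \<Phi> \<and>
    (\<forall>W nrm. admissible X W nrm \<longrightarrow>
      \<not> (\<exists>A::real. A > 0 \<and> (\<forall>x. ereal (A * norm x) \<le> ext_norm W nrm (pairing X \<Phi> x))))"
proof -
  have no_bound: "\<not> (\<exists>A::real. A > 0 \<and> (\<forall>x. ereal (A * norm x) \<le> ext_norm W nrm (pairing X \<Phi> x)))"
    if "admissible X W nrm" for W nrm
    using no_lower_frame_bound[OF assms(1,2,4,5) that] by (fastforce simp flip: not_le)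
  then have "\<not> frame X smul \<Phi>" unfolding frame_def by blast
  with no_bound show ?thesis by blast
qed

end
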